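(* There is an absolute constant $C>0$ such that for every positive integer $d$, the hypercube $Q_d$ is not $\frac{C\cdot 2^d}{d}$-minor-universal; that is, for every $d$ there exists a graph $H$ with no isolated vertices and at most $C\cdot 2^d/d$ edges such that $H$ is not a minor of $Q_d$.
   Context: The $d$-dimensional hypercube $Q_d$ is the graph whose vertices are the binary strings of length $d$, two vertices being adjacent whenever their Hamming distance is one. A graph $H$ is a minor of a graph $G$ if $H$ can be obtained from $G$ by a finite sequence of edge deletions, vertex deletions and edge contractions. A graph $G$ is called $m$-minor-universal if every graph $H$ with at most $m$ edges and no isolated vertices is a minor of $G$. *)

theory Defs
  imports Complex_Main
begin

record 'a ugraph =
  verts :: "'a set"
  edges :: "'a set set"

definition simple_graph :: "'a ugraph \<Rightarrow> bool" where
  "simple_graph G \<longleftrightarrow>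
     finite (verts G) \<and> (\<forall>e\<in>edges G. e \<subseteq> verts G \<and> card e = 2)"

definition no_isolated :: "'a ugraph \<Rightarrow> bool" where
  "no_isolated G \<longleftrightarrow> (\<forall>v\<in>verts G. \<exists>e\<in>edges G. v \<in> e)"

definition graph_iso :: "'a ugraph \<Rightarrow> 'b ugraph \<Rightarrow> bool" where
  "graph_iso G H \<longleftrightarrow>
     (\<exists>f. bij_betw f (verts G) (verts H) \<and> edges H = (\<lambda>e. f ` e) ` edges G)"

definition delete_edge :: "'a set \<Rightarrow> 'a ugraph \<Rightarrow> 'a ugraph" where
  "delete_edge e G = \<lparr>verts = verts G, edges = edges G - {e}\<rparr>"

definition delete_vertex :: "'a \<Rightarrow> 'a ugraph \<Rightarrow> 'a ugraph" where
  "delete_vertex v G = \<lparr>verts = verts G - {v}, edges = {e \<in> edges G. v \<notin> e}\<rparr>"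

text \<open>Contraction of the edge \<open>{u, v}\<close>: the merged vertex keeps the name \<open>u\<close>. The image of
  the contracted edge is the singleton \<open>{u}\<close>, which is discarded; parallel edges are merged
  because edges form a set.\<close>

definition contract_edge :: "'a \<Rightarrow> 'a \<Rightarrow> 'a ugraph \<Rightarrow> 'a ugraph" where
  "contract_edge u v G =
     \<lparr>verts = verts G - {v},
      edges = (\<lambda>e. (\<lambda>x. if x = v then u else x) ` e) ` edges G - {{u}}\<rparr>"

inductive minor_step :: "'a ugraph \<Rightarrow> 'a ugraph \<Rightarrow> bool" where
  del_edge: "e \<in> edges G \<Longrightarrow> minor_step G (delete_edge e G)"
| del_vertex: "v \<in> verts G \<Longrightarrow> minor_step G (delete_vertex v G)"
| contract: "{u, v} \<in> edges G \<Longrightarrow> u \<noteq> v \<Longrightarrow> minor_step G (contract_edge u v G)"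

definition minor_of :: "'b ugraph \<Rightarrow> 'a ugraph \<Rightarrow> bool" where
  "minor_of H G \<longleftrightarrow> (\<exists>G'. minor_step\<^sup>*\<^sup>* G G' \<and> graph_iso G' H)"

text \<open>Graphs are finite and \<open>minor_of\<close> is invariant under isomorphism, so letting \<open>H\<close> range over
  graphs with vertices in \<open>nat\<close> covers all graphs. The bound \<open>m\<close> need not be an integer.\<close>

definition minor_universal :: "real \<Rightarrow> 'a ugraph \<Rightarrow> bool" where
  "minor_universal m G \<longleftrightarrow>
     (\<forall>H :: nat ugraph. simple_graph H \<and> no_isolated H \<and> real (card (edges H)) \<le> m
        \<longrightarrow> minor_of H G)"

definition hamming_dist :: "bool list \<Rightarrow> bool list \<Rightarrow> nat" where
  "hamming_dist x y = card {i. i < length x \<and> x ! i \<noteq> y ! i}"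

definition hypercube :: "nat \<Rightarrow> bool list ugraph" where
  "hypercube d =
     \<lparr>verts = {x. length x = d},
      edges = {{x, y} | x y. length x = d \<and> length y = d \<and> hamming_dist x y = 1}\<rparr>"

lemma simple_graph_hypercube: "simple_graph (hypercube d)"
proof -
  have "finite {x :: bool list. length x = d}"
    using finite_lists_length_eq[of "UNIV :: bool set" d] by simp
  moreover have "x \<noteq> y" if "hamming_dist x y = 1" for x y
    using that by (auto simp: hamming_dist_def)
  ultimately show ?thesis
    by (fastforce simp: simple_graph_def hypercube_def card_insert_if)
qed

lemma simple_graph_minor_step:
  assumes "minor_step G G'" "simple_graph G"
  shows "simple_graph G'"
  using assms(1)
proof cases
  case (contract u v)
  define f where "f = (\<lambda>x. if x = v then u else x)"
  have uv: "u \<in> verts G" "u \<noteq> v"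
    using contract assms(2) by (auto simp: simple_graph_def)
  have f_in: "f x \<in> verts G - {v}" if "x \<in> verts G" for x
    using that uv by (simp add: f_def)
  have f_eq: "f a = u" if "f a = f b" "a \<noteq> b" for a b
    using that by (simp add: f_def split: if_splits)
  have "f ` e \<subseteq> verts G - {v} \<and> card (f ` e) = 2" if e: "e \<in> edges G" "f ` e \<noteq> {u}" for e
  proof -
    have "e \<subseteq> verts G" "card e = 2"
      using e(1) assms(2) by (simp_all add: simple_graph_def)
    moreover from \<open>card e = 2\<close> obtain a b where ab: "e = {a, b}" "a \<noteq> b"
      by (meson card_2_iff)
    moreover have "f a \<noteq> f b"
      using f_eq[of a b] ab e(2) by force
    ultimately show ?thesis
      using f_in by simp
  qed
  moreover have "finite (verts G)"
    using assms(2) by (simp add: simple_graph_def)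
  ultimately show ?thesis
    unfolding contract(1) simple_graph_def contract_edge_def f_def[symmetric] by auto
qed (use assms(2) in \<open>auto simp: simple_graph_def delete_edge_def delete_vertex_def\<close>)

end

theory Submission
  imports Defs "HOL-Library.FuncSet" "HOL-Library.Disjoint_Sets"
begin

text \<open>
  Let \<open>N = 2 ^ d\<close> and let \<open>H\<close> have bounded degree and order \<open>2 n\<close> with \<open>n\<close> a large multiple of
  \<open>N / d\<close>. The branch sets of a model of \<open>H\<close> in the cube are disjoint, so most of them have
  at most \<open>d / 120\<close> elements, and representatives \<open>r\<close> of the two ends of most edges of \<open>H\<close> are at
  distance at most \<open>d / 60\<close>. A Hamming ball of this radius has at most \<open>N powr (1 / 4)\<close> points.
  Given \<open>r\<close>, one end of such an edge therefore leaves few choices for the other, and there are only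
  \<open>N ^ (2 n)\<close> possible \<open>r\<close>. So few graphs \<open>H\<close> are minors, fewer than there are
  permutations \<open>\<pi>\<close> of \<open>16 n\<close> points, each of which yields a graph of maximum degree \<open>16\<close>.
\<close>

section \<open>Minor models as disjoint families of sets of small diameter\<close>

text \<open>The only trace of connectivity of the branch sets that is kept is that the diameter of a
  branch set is less than its cardinality.\<close>

definition distance_model ::
    "('a \<Rightarrow> 'a \<Rightarrow> nat) \<Rightarrow> 'a set \<Rightarrow> 'b ugraph \<Rightarrow> ('b \<Rightarrow> 'a set) \<Rightarrow> bool" where
  "distance_model \<delta> X H B \<longleftrightarrow>
     (\<forall>v\<in>verts H. B v \<subseteq> X \<and> finite (B v) \<and> B v \<noteq> {} \<and> (\<forall>x\<in>B v. \<forall>y\<in>B v. \<delta> x y < card (B v))) \<and>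
     disjoint_family_on B (verts H) \<and>
     (\<forall>e\<in>edges H. \<forall>a\<in>e. \<forall>b\<in>e. \<exists>x\<in>B a. \<exists>y\<in>B b. \<delta> x y \<le> 1)"

text \<open>A path from one branch set to the other uses one step of length at most 1 and two
  distances below the cardinalities, so it stays below their sum. Disjointness makes this sum the
  cardinality of the merged set.\<close>

lemma distance_model_contract_edge:
  assumes model: "distance_model \<delta> X G B" and G: "simple_graph G"
    and uv: "{u, v} \<in> edges G" "u \<noteq> v"
    and triangle: "\<And>x y z. x \<in> X \<Longrightarrow> y \<in> X \<Longrightarrow> z \<in> X \<Longrightarrow> \<delta> x z \<le> \<delta> x y + \<delta> y z"
  shows "distance_model \<delta> X (contract_edge u v G) (B(u := B u \<union> B v))"
proof -
  let ?B = "B(u := B u \<union> B v)"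
  let ?f = "\<lambda>x. if x = v then u else x"
  have V: "u \<in> verts G" "v \<in> verts G"
    using uv G by (auto simp: simple_graph_def)
  have sub: "B w \<subseteq> X" "finite (B w)" "B w \<noteq> {}" if "w \<in> verts G" for w
    using model that by (auto simp: distance_model_def)
  have diam: "\<delta> x y < card (B w)" if "w \<in> verts G" "x \<in> B w" "y \<in> B w" for w x y
    using model that by (auto simp: distance_model_def)
  have disj: "disjoint_family_on B (verts G)"
    using model by (simp add: distance_model_def)
  have edge: "\<exists>x\<in>B a. \<exists>y\<in>B b. \<delta> x y \<le> 1" if "e \<in> edges G" "a \<in> e" "b \<in> e" for e a b
    using model that by (auto simp: distance_model_def)
  have card_uv: "card (B u \<union> B v) = card (B u) + card (B v)"
    using disj V uv(2) sub by (intro card_Un_disjoint) (auto simp: disjoint_family_on_def)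
  \<comment> \<open>Both orders of the two ends are covered, as \<open>\<delta>\<close> is not
    assumed symmetric.\<close>
  have across: "\<delta> x y < card (B u) + card (B v)"
    if ab: "a \<in> {u, v}" "b \<in> {u, v}" "a \<noteq> b" and xy: "x \<in> B a" "y \<in> B b" for a b x y
  proof -
    obtain p q where pq: "p \<in> B a" "q \<in> B b" "\<delta> p q \<le> 1"
      using edge[OF uv(1) ab(1,2)] by blast
    have ab_V: "a \<in> verts G" "b \<in> verts G"
      using ab V by auto
    then have X: "x \<in> X" "y \<in> X" "p \<in> X" "q \<in> X"
      using sub(1) xy pq by blast+
    have "\<delta> x y \<le> \<delta> x p + (\<delta> p q + \<delta> q y)"
      using triangle[of x p y] triangle[of p q y] X by linarith
    moreover have "\<delta> x p < card (B a)" "\<delta> q y < card (B b)"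
      using diam ab_V xy pq by blast+
    moreover have "card (B a) + card (B b) = card (B u) + card (B v)"
      using ab by auto
    ultimately show ?thesis
      using pq(3) by linarith
  qed
  have "\<delta> x y < card (B u \<union> B v)" if "x \<in> B u \<union> B v" "y \<in> B u \<union> B v" for x y
    using that across[of u v x y] across[of v u x y] diam[of u x y] diam[of v x y] V uv(2)
    unfolding card_uv by (auto intro: less_le_trans)
  then have "\<forall>w\<in>verts (contract_edge u v G). ?B w \<subseteq> X \<and> finite (?B w) \<and> ?B w \<noteq> {} \<and>
      (\<forall>x\<in>?B w. \<forall>y\<in>?B w. \<delta> x y < card (?B w))"
    using V sub diam by (simp add: contract_edge_def)
  moreover have "\<forall>e\<in>edges (contract_edge u v G). \<forall>a\<in>e. \<forall>b\<in>e. \<exists>x\<in>?B a. \<exists>y\<in>?B b. \<delta> x y \<le> 1"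
  proof (intro ballI)
    fix e' a b assume e': "e' \<in> edges (contract_edge u v G)" "a \<in> e'" "b \<in> e'"
    then obtain e where "e \<in> edges G" "e' = ?f ` e"
      unfolding contract_edge_def by auto
    with e' obtain a' b' where "e \<in> edges G" "a' \<in> e" "b' \<in> e" "a = ?f a'" "b = ?f b'"
      by blast
    moreover have "B c \<subseteq> ?B (?f c)" for c
      by auto
    ultimately show "\<exists>x\<in>?B a. \<exists>y\<in>?B b. \<delta> x y \<le> 1"
      using edge[of e a' b'] by blast
  qed
  \<comment> \<open>The set \<open>B v\<close> now overlaps the new value at \<open>u\<close>, but
    \<open>v\<close> is no longer a vertex.\<close>
  moreover have "disjoint_family_on ?B (verts (contract_edge u v G))"
    using disj V by (auto simp: disjoint_family_on_def contract_edge_def)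
  ultimately show ?thesis
    unfolding distance_model_def by (intro conjI)
qed

text \<open>Singletons form the initial model; there the strict diameter bound holds by
  \<open>\<delta> x x = 0\<close>. Deletions keep the family and contractions merge two members.
  Simplicity is carried through the induction because contraction asks for it.\<close>

lemma distance_model_minor_steps:
  assumes "minor_step\<^sup>*\<^sup>* G G'" and "simple_graph G"
    and triangle: "\<And>x y z. x \<in> verts G \<Longrightarrow> y \<in> verts G \<Longrightarrow> z \<in> verts G \<Longrightarrow> \<delta> x z \<le> \<delta> x y + \<delta> y z"
    and refl: "\<And>x. \<delta> x x = 0"
    and edge: "\<And>e x y. e \<in> edges G \<Longrightarrow> x \<in> e \<Longrightarrow> y \<in> e \<Longrightarrow> \<delta> x y \<le> 1"
  shows "simple_graph G' \<and> (\<exists>B. distance_model \<delta> (verts G) G' B)"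
  using assms(1)
proof (induction rule: rtranclp_induct)
  case base
  have "distance_model \<delta> (verts G) G (\<lambda>v. {v})"
    using refl edge by (auto simp: distance_model_def disjoint_family_on_def)
  then show ?case
    using assms(2) by blast
next
  case (step G1 G2)
  then obtain B where B: "distance_model \<delta> (verts G) G1 B" and G1: "simple_graph G1"
    by blast
  from step.hyps(2) have "\<exists>B'. distance_model \<delta> (verts G) G2 B'"
  proof cases
    case (contract u v)
    then show ?thesis
      using distance_model_contract_edge[OF B G1 _ _ triangle] by blast
  next
    case (del_edge e)
    then show ?thesis
      using B by (intro exI[of _ B]) (auto simp: distance_model_def delete_edge_def)
  next
    case (del_vertex v)
    have "disjoint_family_on B (verts G1 - {v})"
      using B by (auto simp: distance_model_def intro: disjoint_family_on_mono[of _ "verts G1"])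
    with del_vertex show ?thesis
      using B by (intro exI[of _ B]) (auto simp: distance_model_def delete_vertex_def)
  qed
  then show ?case
    using simple_graph_minor_step[OF step.hyps(2) G1] by blast
qed

lemma distance_model_iso:
  assumes "distance_model \<delta> X G B" and G: "simple_graph G" and "graph_iso G H"
  shows "\<exists>B'. distance_model \<delta> X H B'"
proof -
  from assms(3) obtain f where f: "bij_betw f (verts G) (verts H)"
    and E: "edges H = (\<lambda>e. f ` e) ` edges G"
    by (auto simp: graph_iso_def)
  let ?g = "inv_into (verts G) f"
  have g: "?g (f v) = v" if "v \<in> verts G" for v
    using f that by (simp add: bij_betw_inv_into_left)
  have VH: "verts H = f ` verts G"
    using f by (simp add: bij_betw_def)
  have sub: "e \<subseteq> verts G" if "e \<in> edges G" for e
    using G that by (simp add: simple_graph_def)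
  have "\<forall>v\<in>verts H. (B \<circ> ?g) v \<subseteq> X \<and> finite ((B \<circ> ?g) v) \<and> (B \<circ> ?g) v \<noteq> {} \<and>
      (\<forall>x\<in>(B \<circ> ?g) v. \<forall>y\<in>(B \<circ> ?g) v. \<delta> x y < card ((B \<circ> ?g) v))"
    using assms(1) by (simp add: distance_model_def VH g)
  moreover have "disjoint_family_on (B \<circ> ?g) (verts H)"
    unfolding disjoint_family_on_def VH
  proof (intro ballI impI)
    fix a b assume "a \<in> f ` verts G" "b \<in> f ` verts G" "a \<noteq> b"
    then obtain a' b' where *: "a' \<in> verts G" "b' \<in> verts G" "a' \<noteq> b'" "a = f a'" "b = f b'"
      by blast
    then have "B a' \<inter> B b' = {}"
      using assms(1) by (simp add: distance_model_def disjoint_family_on_def)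
    then show "(B \<circ> ?g) a \<inter> (B \<circ> ?g) b = {}"
      by (simp add: * g)
  qed
  moreover have "\<forall>e\<in>edges H. \<forall>a\<in>e. \<forall>b\<in>e. \<exists>x\<in>(B \<circ> ?g) a. \<exists>y\<in>(B \<circ> ?g) b. \<delta> x y \<le> 1"
  proof (intro ballI)
    fix e a b assume "e \<in> edges H" "a \<in> e" "b \<in> e"
    then obtain e' a' b' where *: "e' \<in> edges G" "a' \<in> e'" "b' \<in> e'" "a = f a'" "b = f b'"
      unfolding E by blast
    then have "a' \<in> verts G" "b' \<in> verts G"
      using sub by blast+
    moreover have "\<exists>x\<in>B a'. \<exists>y\<in>B b'. \<delta> x y \<le> 1"
      using assms(1) *(1-3) unfolding distance_model_def by blast
    ultimately show "\<exists>x\<in>(B \<circ> ?g) a. \<exists>y\<in>(B \<circ> ?g) b. \<delta> x y \<le> 1"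
      by (simp add: *(4,5) g)
  qed
  ultimately have "distance_model \<delta> X H (B \<circ> ?g)"
    unfolding distance_model_def by (intro conjI)
  then show ?thesis
    by blast
qed

section \<open>Hamming distance and the size of balls in the cube\<close>

lemma finite_length_eq_bool: "finite {x :: bool list. length x = d}"
  using finite_lists_length_eq[of "UNIV :: bool set" d] by simp

lemma card_length_eq_bool: "card {x :: bool list. length x = d} = 2 ^ d"
  using card_lists_length_eq[of "UNIV :: bool set" d] by simp

lemma hamming_dist_refl: "hamming_dist x x = 0"
  by (simp add: hamming_dist_def)

lemma hamming_dist_commute: "length x = length y \<Longrightarrow> hamming_dist x y = hamming_dist y x"
  unfolding hamming_dist_def by (rule arg_cong[where f = card]) auto

lemma hamming_dist_triangle:
  assumes "length x = length y" "length y = length z"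
  shows "hamming_dist x z \<le> hamming_dist x y + hamming_dist y z"
proof -
  have "{i. i < length x \<and> x ! i \<noteq> z ! i} \<subseteq>
      {i. i < length x \<and> x ! i \<noteq> y ! i} \<union> {i. i < length y \<and> y ! i \<noteq> z ! i}"
    using assms by auto
  from card_mono[OF _ this] show ?thesis
    unfolding hamming_dist_def by (auto intro: order_trans[OF _ card_Un_le])
qed

lemma hamming_dist_Cons:
  "hamming_dist (a # x) (b # y) = (if a = b then 0 else 1) + hamming_dist x y"
proof -
  have "{i. i < length (a # x) \<and> (a # x) ! i \<noteq> (b # y) ! i} =
      (if a = b then {} else {0}) \<union> Suc ` {i. i < length x \<and> x ! i \<noteq> y ! i}" (is "?L = ?R")
  proof (rule set_eqI)
    fix i show "i \<in> ?L \<longleftrightarrow> i \<in> ?R"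
      by (cases i) auto
  qed
  then show ?thesis
    unfolding hamming_dist_def by (simp add: card_image)
qed

lemma minor_of_hypercube_model:
  assumes "minor_of H (hypercube d)"
  shows "\<exists>B. distance_model hamming_dist {x. length x = d} H B"
proof -
  from assms obtain G where G: "minor_step\<^sup>*\<^sup>* (hypercube d) G" "graph_iso G H"
    by (auto simp: minor_of_def)
  have verts: "verts (hypercube d) = {x. length x = d}"
    by (simp add: hypercube_def)
  have "hamming_dist x y \<le> 1" if "e \<in> edges (hypercube d)" "x \<in> e" "y \<in> e" for e x y
    using that by (auto simp: hypercube_def hamming_dist_refl hamming_dist_commute)
  then have "simple_graph G \<and> (\<exists>B. distance_model hamming_dist (verts (hypercube d)) G B)"
    by (intro distance_model_minor_steps[OF G(1) simple_graph_hypercube])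
      (auto simp: verts hamming_dist_refl intro!: hamming_dist_triangle)
  then show ?thesis
    using distance_model_iso G(2) unfolding verts by blast
qed

text \<open>Each coordinate contributes an independent factor: 1 for agreement, \<open>t\<close> for
  disagreement.\<close>

lemma sum_power_hamming_dist:
  fixes t :: "'a :: comm_semiring_1"
  shows "(\<Sum>y\<in>{y. length y = length x}. t ^ hamming_dist x y) = (1 + t) ^ length x"
proof (induction x)
  case Nil
  then show ?case
    by (simp add: hamming_dist_def)
next
  case (Cons a x)
  let ?S = "{y :: bool list. length y = length x}"
  have split: "{y. length y = length (a # x)} = (#) a ` ?S \<union> (#) (\<not> a) ` ?S"
  proof (intro equalityI subsetI)
    fix y :: "bool list" assume "y \<in> {y. length y = length (a # x)}"
    then obtain b z where "y = b # z" "length z = length x"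
      by (auto simp: length_Suc_conv)
    then show "y \<in> (#) a ` ?S \<union> (#) (\<not> a) ` ?S"
      by (cases "b = a") auto
  qed auto
  have "(\<Sum>y\<in>{y. length y = length (a # x)}. t ^ hamming_dist (a # x) y) =
      (\<Sum>y\<in>?S. t ^ hamming_dist x y) + (\<Sum>y\<in>?S. t * t ^ hamming_dist x y)"
    unfolding split by (subst sum.union_disjoint)
      (auto simp: finite_length_eq_bool sum.reindex hamming_dist_Cons)
  then show ?case
    using Cons.IH by (simp add: sum_distrib_left[symmetric] algebra_simps)
qed

text \<open>Exponential moment bound with weight \<open>t = 1 / 8\<close>: a point of the ball
  weighs at least \<open>8 powr - (d / 60) = 2 powr - (d / 20)\<close>, the whole cube weighs
  \<open>(9 / 8) ^ d\<close>, which is at most \<open>2 powr (d / 5)\<close>, and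
  \<open>1 / 20 + 1 / 5 = 1 / 4\<close>.\<close>

lemma card_hamming_ball_le:
  assumes "length x = d"
  shows "real (card {y. length y = d \<and> 60 * hamming_dist x y \<le> d}) \<le> 2 powr (d / 4)"
proof -
  let ?D = "{y. length y = d \<and> 60 * hamming_dist x y \<le> d}"
  have fin: "finite ?D"
    using finite_length_eq_bool[of d] by (rule rev_finite_subset) auto
  have "2 powr - (d / 20) \<le> (1 / 8 :: real) ^ hamming_dist x y" if "y \<in> ?D" for y
  proof -
    have "(1 / 8 :: real) ^ hamming_dist x y = 2 powr - (3 * hamming_dist x y)"
      using powr_realpow[of 2 "3 * hamming_dist x y"]
      by (simp add: powr_minus power_mult power_one_over inverse_eq_divide)
    moreover have "60 * real (hamming_dist x y) \<le> d"
      using that by simp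
    ultimately show ?thesis
      by simp
  qed
  then have "card ?D * 2 powr - (d / 20) \<le> (\<Sum>y\<in>?D. (1 / 8 :: real) ^ hamming_dist x y)"
    using sum_bounded_below[of ?D "2 powr - (real d / 20)" "\<lambda>y. (1 / 8 :: real) ^ hamming_dist x y"] by simp
  also have "\<dots> \<le> (\<Sum>y\<in>{y. length y = length x}. (1 / 8 :: real) ^ hamming_dist x y)"
    using assms finite_length_eq_bool by (intro sum_mono2) auto
  also have "\<dots> = (9 / 8) ^ d"
    using sum_power_hamming_dist[where x = x and t = "1 / 8 :: real"] by (simp add: assms)
  also have "(9 / 8 :: real) ^ d \<le> (2 powr (1 / 5)) ^ d"
  proof (rule power_mono)
    \<comment> \<open>Rests on \<open>(9 / 8) ^ 5 = 59049 / 32768 < 2\<close>.\<close>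
    have "(9 / 8 :: real) = ((9 / 8) powr 5) powr (1 / 5)"
      by (simp only: powr_powr) simp
    also have "\<dots> \<le> 2 powr (1 / 5)"
      by (intro powr_mono2) (simp_all add: field_simps)
    finally show "(9 / 8 :: real) \<le> 2 powr (1 / 5)" .
  qed simp
  also have "\<dots> = 2 powr (d / 5)"
    by (simp add: powr_powr flip: powr_realpow)
  finally have "card ?D * 2 powr - (d / 20) * 2 powr (d / 20) \<le> 2 powr (d / 5) * 2 powr (d / 20)"
    by (simp add: mult_right_mono)
  then show ?thesis
    by (simp add: mult.assoc flip: powr_add)
qed

section \<open>Counting estimates\<close>

text \<open>The quotient \<open>n ^ n / fact n\<close> is a single term of the series for
  \<open>exp n\<close>, and \<open>exp 1 \<le> 3\<close>.\<close>

lemma power_self_le_fact: "real n ^ n \<le> 3 ^ n * fact n"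
proof -
  have "(\<Sum>i\<in>{n}. real n ^ i /\<^sub>R fact i) \<le> (\<Sum>i. real n ^ i /\<^sub>R fact i)"
    by (intro sum_le_suminf summable_exp_generic) auto
  also have "\<dots> = exp (real n)"
    by (simp only: exp_def)
  also have "\<dots> = exp 1 ^ n"
    by (simp flip: exp_of_nat_mult)
  also have "\<dots> \<le> 3 ^ n"
    by (intro power_mono exp_le) simp
  finally show ?thesis
    by (simp add: field_simps)
qed

text \<open>Injectivity of \<open>g\<close> makes \<open>(g (w div k), w mod k)\<close> determine
  \<open>w\<close>. This turns a bound on points of the cube into a bound on ports, \<open>k\<close>
  of which belong to each vertex.\<close>

lemma card_div_preimage_le:
  fixes g :: "nat \<Rightarrow> 'a"
  assumes "inj_on g {..<n}" and "finite S" and "k > 0"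
  shows "card {w. w < k * n \<and> g (w div k) \<in> S} \<le> k * card S"
proof -
  have "inj_on (\<lambda>w. (g (w div k), w mod k)) {w. w < k * n \<and> g (w div k) \<in> S}"
  proof (rule inj_onI, clarsimp)
    fix w w' assume "w < k * n" "w' < k * n" "g (w div k) = g (w' div k)" "w mod k = w' mod k"
    moreover from this have "w div k = w' div k"
      using inj_onD[OF assms(1)] by (simp add: less_mult_imp_div_less mult.commute)
    ultimately show "w = w'"
      by (metis mult_div_mod_eq)
  qed
  then have "card {w. w < k * n \<and> g (w div k) \<in> S} \<le> card (S \<times> {..<k})"
    using assms by (intro card_inj_on_le[where f = "\<lambda>w. (g (w div k), w mod k)"]) auto
  then show ?thesis
    by (simp add: card_cartesian_product mult.commute)
qed

text \<open>Union bound over \<open>G\<close>: there are at most \<open>2 ^ (2 * m) = 4 ^ m\<close>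
  such sets, and for each of them at least \<open>m\<close> arguments have at most \<open>W\<close>
  values, the others \<open>card A\<close>.\<close>

lemma card_mostly_constrained_funs_le:
  fixes W :: real
  assumes A: "finite A" "card A = 2 * m"
    and T: "\<And>u. u \<in> A \<Longrightarrow> finite (T u)" "\<And>u. u \<in> A \<Longrightarrow> card (T u) \<le> W"
    and W: "0 < W" "W \<le> card A"
  shows "real (card {f \<in> A \<rightarrow>\<^sub>E A. \<exists>G\<subseteq>A. card A \<le> 2 * card G \<and> (\<forall>u\<in>G. f u \<in> T u)})
    \<le> 4 ^ m * (W * card A) ^ m"
proof -
  let ?M = "real (card A)"
  let ?F = "\<lambda>G. \<Pi>\<^sub>E u\<in>A. if u \<in> G then T u else A"
  let ?\<G> = "{G. G \<subseteq> A \<and> card A \<le> 2 * card G}"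
  have fin: "finite ?\<G>" "finite (?F G)" for G
    using A T by (auto intro!: finite_PiE)
  have F: "real (card (?F G)) \<le> (W * ?M) ^ m" if "G \<in> ?\<G>" for G
  proof -
    have G: "G \<subseteq> A" "m \<le> card G" "card G \<le> 2 * m" "finite G"
      using that A card_mono[of A G] finite_subset by auto
    have "real (card (?F G)) = (\<Prod>u\<in>A. if u \<in> G then real (card (T u)) else ?M)"
      using A by (simp add: card_PiE if_distrib)
    also have "\<dots> \<le> (\<Prod>u\<in>A. if u \<in> G then W else ?M)"
      using T(2) by (intro prod_mono) auto
    also have "\<dots> = W ^ card G * ?M ^ card (A - G)"
      using A(1) G(1) by (simp add: prod.If_cases Int_absorb1 Diff_eq)
    also have "card (A - G) = 2 * m - card G"
      using A G by (simp add: card_Diff_subset)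
    \<comment> \<open>Beyond the first \<open>m\<close>, the factors \<open>W\<close> are relaxed to
      \<open>card A\<close>, so that the bound no longer depends on \<open>card G\<close>.\<close>
    also have "W ^ card G = W ^ m * W ^ (card G - m)"
      using G by (simp flip: power_add)
    also have "\<dots> * ?M ^ (2 * m - card G) \<le> W ^ m * ?M ^ (card G - m) * ?M ^ (2 * m - card G)"
      using W by (intro mult_right_mono mult_left_mono power_mono) auto
    also have "\<dots> = (W * ?M) ^ m"
      using G by (simp add: power_mult_distrib mult.assoc flip: power_add)
    finally show ?thesis .
  qed
  have "{f \<in> A \<rightarrow>\<^sub>E A. \<exists>G\<subseteq>A. card A \<le> 2 * card G \<and> (\<forall>u\<in>G. f u \<in> T u)} \<subseteq> (\<Union>G\<in>?\<G>. ?F G)"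
    by (fastforce simp: PiE_iff)
  then have "card {f \<in> A \<rightarrow>\<^sub>E A. \<exists>G\<subseteq>A. card A \<le> 2 * card G \<and> (\<forall>u\<in>G. f u \<in> T u)}
      \<le> card (\<Union>G\<in>?\<G>. ?F G)"
    using fin by (intro card_mono) auto
  also have "\<dots> \<le> (\<Sum>G\<in>?\<G>. card (?F G))"
    using fin by (intro card_UN_le)
  finally have "real (card {f \<in> A \<rightarrow>\<^sub>E A. \<exists>G\<subseteq>A. card A \<le> 2 * card G \<and> (\<forall>u\<in>G. f u \<in> T u)})
      \<le> (\<Sum>G\<in>?\<G>. real (card (?F G)))"
    using of_nat_mono by fastforce
  also have "\<dots> \<le> card ?\<G> * (W * ?M) ^ m"
    using F by (rule sum_bounded_above)
  also have "real (card ?\<G>) \<le> real (card (Pow A))"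
    using A by (intro of_nat_mono card_mono) auto
  also have "real (card (Pow A)) = 4 ^ m"
    using A by (simp add: card_Pow power_mult)
  finally show ?thesis
    using W by (simp add: mult_right_mono)
qed

section \<open>Graphs of bounded degree from permutations, and their models in the cube\<close>

text \<open>Each vertex has \<open>k\<close> ports, port \<open>u\<close> belonging to vertex \<open>u div k\<close> on its side,
  and \<open>\<pi>\<close> joins the ports on the left to those on the right. Parallel edges collapse, so distinct
  \<open>\<pi>\<close> may give the same graph; the count is therefore one of permutations, not of graphs.\<close>

definition perm_graph :: "nat \<Rightarrow> nat \<Rightarrow> (nat \<Rightarrow> nat) \<Rightarrow> nat ugraph" where
  "perm_graph k n \<pi> =
     \<lparr>verts = {..<2 * n}, edges = (\<lambda>u. {u div k, n + \<pi> u div k}) ` {..<k * n}\<rparr>"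

lemma
  assumes \<pi>: "\<pi> \<in> {..<k * n} \<rightarrow>\<^sub>E {..<k * n}" "inj_on \<pi> {..<k * n}" and "k > 0"
  shows simple_graph_perm_graph: "simple_graph (perm_graph k n \<pi>)"
    and no_isolated_perm_graph: "no_isolated (perm_graph k n \<pi>)"
    and card_edges_perm_graph_le: "card (edges (perm_graph k n \<pi>)) \<le> k * n"
proof -
  have div: "u div k < n" if "u < k * n" for u
    using that by (simp add: less_mult_imp_div_less mult.commute)
  have \<pi>_less: "\<pi> u < k * n" if "u < k * n" for u
    using \<pi>(1) that by (auto simp: PiE_iff)
  have less: "u div k < n" "\<pi> u div k < n" if "u < k * n" for u
    using that \<pi>_less div by simp_all
  have "u div k \<noteq> n + \<pi> u div k" if "u < k * n" for u
    using less(1)[OF that] by linarith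
  then show "simple_graph (perm_graph k n \<pi>)"
    using less by (fastforce simp: simple_graph_def perm_graph_def card_insert_if)
  \<comment> \<open>Surjectivity is what gives every vertex on the right an edge.\<close>
  have surj: "\<pi> ` {..<k * n} = {..<k * n}"
    using \<pi>_less by (intro endo_inj_surj \<pi>(2)) auto
  have "\<exists>u<k * n. v \<in> {u div k, n + \<pi> u div k}" if "v < 2 * n" for v
  proof (cases "v < n")
    case True
    then show ?thesis
      using assms(3) by (intro exI[of _ "k * v"]) simp
  next
    case False
    then have "k * (v - n) \<in> \<pi> ` {..<k * n}"
      using that assms(3) unfolding surj by simp
    then obtain u where "u < k * n" "\<pi> u = k * (v - n)"
      by auto
    then show ?thesis
      using False assms(3) by (intro exI[of _ u]) simp
  qed
  then show "no_isolated (perm_graph k n \<pi>)"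
    by (force simp: no_isolated_def perm_graph_def)
  show "card (edges (perm_graph k n \<pi>)) \<le> k * n"
    using card_image_le[of "{..<k * n}" "\<lambda>u. {u div k, n + \<pi> u div k}"] by (simp add: perm_graph_def)
qed

text \<open>Disjoint branch sets share \<open>2 ^ d\<close> points, so at most
  \<open>c * 2 ^ d / d \<le> n / 4\<close> of them have more than \<open>d / c\<close> elements. On
  each side at most \<open>k * card bad\<close> ports lie at such vertices, so at least half of the
  \<open>k * n\<close> pairs of ports avoid them. Such a pair joins two small, nearby branch sets,
  which bounds the distance between any of their points.\<close>

lemma perm_graph_model_representatives:
  assumes model: "distance_model hamming_dist {x. length x = d} (perm_graph k n \<pi>) B"
    and \<pi>: "\<pi> \<in> {..<k * n} \<rightarrow>\<^sub>E {..<k * n}" "inj_on \<pi> {..<k * n}" and "k > 0" and "d > 0"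
    and n: "4 * c * 2 ^ d \<le> n * d"
  shows "\<exists>r \<in> {..<2 * n} \<rightarrow>\<^sub>E {x. length x = d}. inj_on r {..<2 * n} \<and>
    (\<exists>G\<subseteq>{..<k * n}. k * n \<le> 2 * card G \<and>
       (\<forall>u\<in>G. c * hamming_dist (r (u div k)) (r (n + \<pi> u div k)) \<le> 2 * d))"
proof -
  have verts: "verts (perm_graph k n \<pi>) = {..<2 * n}"
    by (simp add: perm_graph_def)
  have \<pi>_less: "\<pi> u < k * n" if "u < k * n" for u
    using \<pi>(1) that by (auto simp: PiE_iff)
  have less: "u div k < n" "\<pi> u div k < n" if "u < k * n" for u
    using that \<pi>_less[OF that] by (simp_all add: less_mult_imp_div_less mult.commute)
  have sub: "B v \<subseteq> {x. length x = d}" "finite (B v)" "B v \<noteq> {}" if "v < 2 * n" for v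
    using model that by (auto simp: distance_model_def verts)
  have diam: "hamming_dist x y < card (B v)" if "v < 2 * n" "x \<in> B v" "y \<in> B v" for v x y
    using model that by (auto simp: distance_model_def verts)
  have disj: "disjoint_family_on B {..<2 * n}"
    using model by (simp add: distance_model_def verts)
  \<comment> \<open>Any choice will do. Restriction to \<open>{..<2 * n}\<close> makes
    \<open>r\<close> extensional, hence a member of a finite function space.\<close>
  define r where "r = (\<lambda>v\<in>{..<2 * n}. SOME x. x \<in> B v)"
  have r: "r v \<in> B v" if "v < 2 * n" for v
    using sub(3)[OF that] that by (auto simp: r_def some_in_eq)
  have r_PiE: "r \<in> {..<2 * n} \<rightarrow>\<^sub>E {x. length x = d}"
    using r sub(1) by (intro PiE_I) (blast, simp add: r_def)
  have r_inj: "inj_on r {..<2 * n}"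
  proof (rule inj_onI, rule ccontr)
    fix v w assume "v \<in> {..<2 * n}" "w \<in> {..<2 * n}" "r v = r w" "v \<noteq> w"
    then have "r v \<in> B v" "r v \<in> B w" "B v \<inter> B w = {}"
      using r[of v] r[of w] disj by (simp_all add: disjoint_family_on_def)
    then show False
      by blast
  qed
  define bad where "bad = {v. v < 2 * n \<and> d < c * card (B v)}"
  have "card bad * d \<le> (\<Sum>v\<in>bad. c * card (B v))"
    using sum_bounded_below[of bad d "\<lambda>v. c * card (B v)"] by (force simp: bad_def)
  also have "\<dots> \<le> c * (\<Sum>v\<in>{..<2 * n}. card (B v))"
    unfolding sum_distrib_left by (rule sum_mono2) (auto simp: bad_def)
  also have "(\<Sum>v\<in>{..<2 * n}. card (B v)) = card (\<Union>v\<in>{..<2 * n}. B v)"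
    using disj sub by (intro card_UN_disjoint'[symmetric]) auto
  also have "\<dots> \<le> 2 ^ d"
    unfolding card_length_eq_bool[symmetric] using sub finite_length_eq_bool
    by (intro card_mono) auto
  finally have "card bad * d \<le> c * 2 ^ d"
    by simp
  then have "(4 * card bad) * d \<le> n * d"
    using n by linarith
  then have bad: "4 * card bad \<le> n"
    using \<open>d > 0\<close> by (simp only: mult_le_cancel2)
  have fin_bad: "finite bad"
    by (simp add: bad_def)
  define L where "L = {u. u < k * n \<and> u div k \<in> bad}"
  define R where "R = {u. u < k * n \<and> n + \<pi> u div k \<in> bad}"
  define G where "G = {..<k * n} - (L \<union> R)"
  have "card L \<le> k * card bad"
    unfolding L_def using card_div_preimage_le[of "\<lambda>x. x" n bad k] fin_bad \<open>k > 0\<close> by simp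
  \<comment> \<open>As \<open>\<pi>\<close> is injective, \<open>R\<close> is counted through its
    image, which consists of right ports at bad vertices.\<close>
  moreover have "card R \<le> k * card bad"
  proof -
    have "card R = card (\<pi> ` R)"
      using \<pi>(2) by (intro card_image[symmetric]) (auto simp: R_def inj_on_def)
    also have "\<dots> \<le> card {w. w < k * n \<and> n + w div k \<in> bad}"
      using \<pi>_less by (intro card_mono) (auto simp: R_def)
    also have "\<dots> \<le> k * card bad"
      using fin_bad \<open>k > 0\<close> by (intro card_div_preimage_le) auto
    finally show ?thesis .
  qed
  ultimately have "card (L \<union> R) \<le> 2 * (k * card bad)"
    using card_Un_le[of L R] by linarith
  moreover have "card G = k * n - card (L \<union> R)"
    unfolding G_def by (subst card_Diff_subset) (auto simp: L_def R_def)
  moreover have "4 * (k * card bad) \<le> k * n"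
    using bad by (simp add: mult.left_commute)
  ultimately have card_G: "k * n \<le> 2 * card G"
    by linarith
  have "c * hamming_dist (r (u div k)) (r (n + \<pi> u div k)) \<le> 2 * d" if "u \<in> G" for u
  proof -
    let ?a = "u div k" and ?b = "n + \<pi> u div k"
    have u: "u < k * n" "?a \<notin> bad" "?b \<notin> bad"
      using that by (auto simp: G_def L_def R_def)
    have ab: "?a < 2 * n" "?b < 2 * n"
      using less[OF u(1)] by linarith+
    have "{?a, ?b} \<in> edges (perm_graph k n \<pi>)"
      using u(1) by (auto simp: perm_graph_def)
    moreover have "\<forall>e\<in>edges (perm_graph k n \<pi>). \<forall>a\<in>e. \<forall>b\<in>e. \<exists>x\<in>B a. \<exists>y\<in>B b. hamming_dist x y \<le> 1"
      using model unfolding distance_model_def by (elim conjE)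
    ultimately obtain x y where xy: "x \<in> B ?a" "y \<in> B ?b" "hamming_dist x y \<le> 1"
      by (meson insertI1 insertI2)
    have len: "length (r ?a) = d" "length (r ?b) = d" "length x = d" "length y = d"
      using sub(1) ab r xy by blast+
    have "hamming_dist (r ?a) (r ?b) \<le> hamming_dist (r ?a) x + (hamming_dist x y + hamming_dist y (r ?b))"
      using hamming_dist_triangle[of "r ?a" x "r ?b"] hamming_dist_triangle[of x y "r ?b"] len by simp
    moreover have "hamming_dist (r ?a) x < card (B ?a)" "hamming_dist y (r ?b) < card (B ?b)"
      using diam ab r xy by blast+
    \<comment> \<open>The strict diameter bounds absorb the step of length at most 1 between the
      branch sets.\<close>
    ultimately have "hamming_dist (r ?a) (r ?b) \<le> card (B ?a) + card (B ?b)"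
      using xy(3) by linarith
    then have "c * hamming_dist (r ?a) (r ?b) \<le> c * card (B ?a) + c * card (B ?b)"
      by (metis add_mult_distrib2 mult_le_mono2)
    moreover have "c * card (B ?a) \<le> d" "c * card (B ?b) \<le> d"
      using u ab by (auto simp: bad_def)
    ultimately show ?thesis
      by linarith
  qed
  then show ?thesis
    using r_PiE r_inj card_G by (intro bexI[of _ r] conjI exI[of _ G] ballI) (simp_all add: G_def)
qed

section \<open>Comparing the number of permutations with the number of models\<close>

theorem theorem3p1:
  "\<exists>C::real. C > 0 \<and>
     (\<forall>d::nat. d \<ge> 1 \<longrightarrow> \<not> minor_universal (C * 2 ^ d / real d) (hypercube d))"
proof (intro exI[of _ "7696 :: real"] conjI allI impI notI)
  fix d :: nat
  assume "d \<ge> 1" and univ: "minor_universal (7696 * 2 ^ d / real d) (hypercube d)"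
  \<comment> \<open>Here \<open>480 = 4 * 120\<close> meets the size condition on \<open>n\<close>
    for \<open>c = 120\<close>. The \<open>+ 1\<close> makes up for rounding and, by
    \<open>d < 2 ^ d\<close>, costs at most \<open>2 ^ d / d\<close>; hence
    \<open>7696 = 16 * 481\<close>.\<close>
  define n where "n = 480 * 2 ^ d div d + 1"
  \<comment> \<open>The fourth root of \<open>2 ^ d\<close>, which bounds a ball of radius
    \<open>d / 60\<close>.\<close>
  define q :: real where "q = 2 powr (d / 4)"
  define A where "A = {..<16 * n}"
  define X where "X = {x :: bool list. length x = d}"
  \<comment> \<open>The right ports allowed as partners of \<open>u\<close>; \<open>d / 60\<close>
    is the distance bound \<open>2 * d / c\<close> for \<open>c = 120\<close>.\<close>
  define T where "T r u = {w. w < 16 * n \<and> r (n + w div 16) \<in>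
      {y. length y = d \<and> 60 * hamming_dist (r (u div 16)) y \<le> d}}" for r :: "nat \<Rightarrow> bool list" and u
  define F where "F r = {f \<in> A \<rightarrow>\<^sub>E A. \<exists>G\<subseteq>A. card A \<le> 2 * card G \<and> (\<forall>u\<in>G. f u \<in> T r u)}" for r
  define R where "R = {r \<in> {..<2 * n} \<rightarrow>\<^sub>E X. inj_on r {..<2 * n}}"

  have card_A: "card A = 2 * (8 * n)" and fin_A: "finite A"
    by (simp_all add: A_def)
  have fin_X: "finite X"
    unfolding X_def by (rule finite_length_eq_bool)
  have q4: "q ^ 4 = 2 ^ d" and q1: "q \<ge> 1"
    by (simp_all add: q_def powr_powr ge_one_powr_ge_zero flip: powr_realpow)
  have d_less: "real d < 2 ^ d"
    using of_nat_less_two_power by blast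

  have n_lower: "480 * 2 ^ d < n * d"
  proof -
    have "480 * 2 ^ d < d + d * (480 * 2 ^ d div d)"
      using \<open>d \<ge> 1\<close> by (intro dividend_less_times_div) simp
    then show ?thesis
      by (simp add: n_def algebra_simps)
  qed
  have edges_bound: "real (16 * n) \<le> 7696 * 2 ^ d / d"
  proof -
    have "n * d \<le> 480 * 2 ^ d + d"
      by (simp add: n_def algebra_simps)
    then have "real (n * d) \<le> real (480 * 2 ^ d + d)"
      by (rule of_nat_mono)
    then have "real n * real d \<le> 481 * 2 ^ d"
      using d_less unfolding of_nat_mult of_nat_add of_nat_power of_nat_numeral by linarith
    then show ?thesis
      using \<open>d \<ge> 1\<close> by (simp add: field_simps)
  qed
  \<comment> \<open>Bernoulli with \<open>7 / 5 < sqrt 2\<close>. Since \<open>n * d\<close> exceeds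
    \<open>480 * q ^ 4\<close>, a bound on \<open>d\<close> of order \<open>q ^ 2\<close> leaves
    \<open>n\<close> above \<open>192 * q ^ 2\<close>.\<close>
  have d_le: "real d \<le> 5 / 2 * q\<^sup>2"
  proof -
    have "1 + d * (7 / 5 - 1) \<le> (7 / 5 :: real) ^ d"
      using Bernoulli_inequality[of "2 / 5 :: real" d] by simp
    also have "\<dots> \<le> sqrt 2 ^ d"
      by (intro power_mono real_le_rsqrt) (simp_all add: power2_eq_square)
    also have "\<dots> = q\<^sup>2"
      by (simp add: q_def powr_half_sqrt[symmetric] powr_powr flip: powr_realpow)
    finally show ?thesis
      by simp
  qed
  have n_large: "192 * q\<^sup>2 < n"
  proof -
    have "480 * (q\<^sup>2 * q\<^sup>2) = 480 * 2 ^ d"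
      unfolding q4[symmetric] by (simp flip: power_add)
    also have "\<dots> < real n * real d"
      using n_lower of_nat_less_iff[of "480 * 2 ^ d" "n * d", where ?'a = real] by simp
    also have "\<dots> \<le> real n * (5 / 2 * q\<^sup>2)"
      using d_le by (intro mult_left_mono) auto
    finally have "(192 * q\<^sup>2) * q\<^sup>2 < real n * q\<^sup>2"
      by (simp add: algebra_simps)
    then show ?thesis
      using q1 by (simp add: mult_less_cancel_right)
  qed

  \<comment> \<open>Universality enters here: each \<open>perm_graph 16 n \<pi>\<close> has a model,
    and the representatives \<open>r\<close> of its branch sets put \<open>\<pi>\<close> into
    \<open>F r\<close>.\<close>
  have "{f \<in> A \<rightarrow>\<^sub>E A. inj_on f A} \<subseteq> (\<Union>r\<in>R. F r)"
  proof
    fix \<pi> assume "\<pi> \<in> {f \<in> A \<rightarrow>\<^sub>E A. inj_on f A}"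
    then have \<pi>: "\<pi> \<in> {..<16 * n} \<rightarrow>\<^sub>E {..<16 * n}" "inj_on \<pi> {..<16 * n}"
      by (auto simp: A_def)
    have "real (card (edges (perm_graph 16 n \<pi>))) \<le> real (16 * n)"
      using card_edges_perm_graph_le[OF \<pi>] by (intro of_nat_mono) simp
    then have "minor_of (perm_graph 16 n \<pi>) (hypercube d)"
      using univ edges_bound simple_graph_perm_graph[OF \<pi>] no_isolated_perm_graph[OF \<pi>]
      unfolding minor_universal_def by force
    then obtain B where "distance_model hamming_dist {x. length x = d} (perm_graph 16 n \<pi>) B"
      using minor_of_hypercube_model by blast
    from perm_graph_model_representatives[OF this \<pi>, of 120]
    obtain r G where r: "r \<in> {..<2 * n} \<rightarrow>\<^sub>E {x. length x = d}" "inj_on r {..<2 * n}"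
      and G: "G \<subseteq> {..<16 * n}" "16 * n \<le> 2 * card G"
        "\<And>u. u \<in> G \<Longrightarrow> 120 * hamming_dist (r (u div 16)) (r (n + \<pi> u div 16)) \<le> 2 * d"
      using n_lower \<open>d \<ge> 1\<close> by auto
    have "\<pi> u \<in> T r u" if "u \<in> G" for u
    proof -
      have "\<pi> u < 16 * n"
        using \<pi>(1) G(1) that by (auto simp: PiE_iff)
      moreover from this have "length (r (n + \<pi> u div 16)) = d"
        using r(1) by (auto simp: PiE_iff)
      ultimately show ?thesis
        using G(3)[OF that] by (simp add: T_def)
    qed
    then have "\<pi> \<in> F r"
      using \<pi> G(1,2) unfolding F_def A_def by auto
    moreover have "r \<in> R"
      using r by (simp add: R_def X_def)
    ultimately show "\<pi> \<in> (\<Union>r\<in>R. F r)"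
      by blast
  qed
  moreover have fin_R: "finite R" and "finite (F r)" for r
    unfolding R_def F_def using fin_A fin_X by (auto intro!: finite_PiE finite_Collect_conjI)
  ultimately have "card {f \<in> A \<rightarrow>\<^sub>E A. inj_on f A} \<le> card (\<Union>r\<in>R. F r)"
    by (intro card_mono) auto
  also have "\<dots> \<le> (\<Sum>r\<in>R. card (F r))"
    by (rule card_UN_le[OF fin_R])
  finally have "real (card {f \<in> A \<rightarrow>\<^sub>E A. inj_on f A}) \<le> (\<Sum>r\<in>R. real (card (F r)))"
    using of_nat_mono by fastforce
  also have "\<dots> \<le> card R * (4 ^ (8 * n) * (16 * q * card A) ^ (8 * n))"
  proof (rule sum_bounded_above)
    fix r assume r: "r \<in> R"
    have "real (card (T r u)) \<le> 16 * q" if u: "u \<in> A" for u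
    proof -
      let ?S = "{y. length y = d \<and> 60 * hamming_dist (r (u div 16)) y \<le> d}"
      have "finite ?S"
        using finite_length_eq_bool[of d] by (rule rev_finite_subset) auto
      \<comment> \<open>Distinct vertices have distinct representatives, so a point of the ball
        accounts for at most 16 ports.\<close>
      moreover have "inj_on (\<lambda>j. r (n + j)) {..<n}"
        using r inj_onD[of r "{..<2 * n}"] by (fastforce simp: R_def intro: inj_onI)
      ultimately have "card (T r u) \<le> 16 * card ?S"
        unfolding T_def by (intro card_div_preimage_le) auto
      then have "real (card (T r u)) \<le> 16 * real (card ?S)"
        using of_nat_mono by fastforce
      moreover have "length (r (u div 16)) = d"
        using r u by (auto simp: R_def A_def X_def PiE_iff)
      ultimately show ?thesis
        using card_hamming_ball_le[of "r (u div 16)" d] unfolding q_def by linarith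
    qed
    \<comment> \<open>Yields the side condition \<open>W \<le> card A\<close> for
      \<open>W = 16 * q\<close>.\<close>
    moreover have "q \<le> n"
    proof -
      have "q \<le> q\<^sup>2"
        using q1 by (simp add: power2_eq_square)
      then show ?thesis
        using n_large q1 by simp
    qed
    ultimately show "real (card (F r)) \<le> 4 ^ (8 * n) * (16 * q * card A) ^ (8 * n)"
      unfolding F_def using fin_A card_A q1
      by (intro card_mostly_constrained_funs_le) (auto simp: T_def)
  qed
  \<comment> \<open>The choice of \<open>2 * n\<close> representatives costs
    \<open>q ^ (8 * n)\<close>. With degree 16 this exponent is half the number of ports, as in the
    other factors.\<close>
  also have "real (card R) \<le> (q ^ 4) ^ (2 * n)"
  proof -
    have "card R \<le> card ({..<2 * n} \<rightarrow>\<^sub>E X)"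
      unfolding R_def using fin_X by (intro card_mono finite_PiE) auto
    also have "\<dots> = (2 ^ d) ^ (2 * n)"
      by (simp add: card_funcsetE X_def card_length_eq_bool)
    finally have "real (card R) \<le> real ((2 ^ d) ^ (2 * n))"
      by (rule of_nat_mono)
    then show ?thesis
      by (simp add: q4)
  qed
  also have "real (card {f \<in> A \<rightarrow>\<^sub>E A. inj_on f A}) = fact (16 * n)"
  proof -
    have "card {f \<in> A \<rightarrow>\<^sub>E A. inj_on f A} = fact (16 * n)"
      using card_inj_on_subset_funcset[of A A A] fin_A card_A
      by (simp add: fact_prod_rev lessThan_atLeast0)
    then show ?thesis
      by simp
  qed
  finally have fact_le: "fact (16 * n) \<le> (q ^ 4) ^ (2 * n) * (4 ^ (8 * n) * (16 * q * card A) ^ (8 * n))"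
    using q1 by (simp add: mult_right_mono)

  \<comment> \<open>All factors become powers with exponent \<open>8 * n\<close>; taking the root
    gives \<open>n \<le> 36 * q ^ 2\<close>, against \<open>n > 192 * q ^ 2\<close>.\<close>
  have "(real (16 * n) * real (16 * n)) ^ (8 * n) = real (16 * n) ^ (16 * n)"
    unfolding power2_eq_square[symmetric] power_mult[symmetric] by simp
  also have "\<dots> \<le> 3 ^ (16 * n) * fact (16 * n)"
    by (rule power_self_le_fact)
  also have "\<dots> \<le> 3 ^ (16 * n) * ((q ^ 4) ^ (2 * n) * (4 ^ (8 * n) * (16 * q * card A) ^ (8 * n)))"
    using fact_le by simp
  also have "(3 :: real) ^ (16 * n) = 9 ^ (8 * n)"
    using power_mult[of "3 :: real" 2 "8 * n"] by simp
  also have "(q ^ 4) ^ (2 * n) = q ^ (8 * n)"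
    by (simp flip: power_mult)
  also have "9 ^ (8 * n) * (q ^ (8 * n) * (4 ^ (8 * n) * (16 * q * card A) ^ (8 * n))) =
      (9 * (q * (4 * (16 * q * card A)))) ^ (8 * n)"
    by (simp only: power_mult_distrib)
  finally have "real (16 * n) * real (16 * n) \<le> 9 * (q * (4 * (16 * q * card A)))"
    using q1 by (subst (asm) power_mono_iff) (auto simp: n_def)
  then have "real n * real n \<le> (36 * q\<^sup>2) * real n"
    by (simp add: card_A power2_eq_square algebra_simps)
  moreover have "real n > 0"
    by (simp add: n_def)
  ultimately have "real n \<le> 36 * q\<^sup>2"
    by (simp only: mult_le_cancel_right_pos)
  then show False
    using n_large q1 by (smt (verit) zero_le_power2)
qed simp

end
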